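(* Let $m\ge n\ge 2$ and let $G=(S,T,E_1\cup E_2)$, with $S=[m]$, $T=[n]$, be an augmented bipartite graph with 1-edge set $E_1$ and 2-edge set $E_2$ satisfying conditions (S), (W1), (W2), (W2') and (W3) (all defined in the context). Then the associated doubly simple biquadratic form $$P_G(\mathbf{x},\mathbf{y})=\sum_{(i,j)\in E_1}x_i^2y_j^2+\sum_{(i,j;k,l)\in E_2}(x_iy_j+x_ky_l)^2$$ is irreducible, i.e. $\mathrm{SOS}(P_G)=|E_1|+|E_2|$.
   Context: Notation: $[m]=\{1,\dots,m\}$. An $m\times n$ biquadratic form is a real polynomial $P(\mathbf{x},\mathbf{y})=\sum_{i,k=1}^m\sum_{j,l=1}^n a_{ijkl}x_ix_ky_jy_l$ (with $a_{ijkl}=a_{kjil}=a_{klij}$). It is SOS if $P=\sum_{p=1}^r f_p^2$ with each $f_p$ a real bilinear form in $(\mathbf{x},\mathbf{y})$; the minimum such $r$ is the SOS rank $\mathrm{SOS}(P)$. Augmented bipartite graphs. A cell is a pair $(i,j)\in[m]\times[n]$ ($i$ is its row, $j$ its column). A 1-edge is a cell; $E_1$ is a set of 1-edges, viewed as a bipartite graph $G_1$ on $S=[m]$, $T=[n]$. A 2-edge is an unordered pair of distinct cells, written $(i,j;k,l)$; the cells $(i,j)$ and $(k,l)$ are its two halves. It is nondegenerate if $i\ne k$ and $j\ne l$, row-degenerate if $i=k$ and $j\neq l$, column-degenerate if $i\ne k$ and $j=l$. $E_2$ is a set of 2-edges. A cell is occupied if it is in $E_1$ or is a half of some 2-edge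 in $E_2$; otherwise it is unoccupied. The opposite cells of a nondegenerate 2-edge $(i,j;k,l)$ are $(i,l)$ and $(k,j)$. Two nondegenerate 2-edges of the form $(i,j;k,l)$ and $(i,l;k,j)$ are called complementary. The dependency graph $\mathcal{D}$ is the directed graph whose vertices are the nondegenerate 2-edges in $E_2$, with an arc $e\to e'$ ($e\ne e'$) if both opposite cells of $e$ are occupied and one half of $e'$ is an opposite cell of $e$. Row and column set: an edge's row (column) set is the set of rows (columns) of its cell (1-edge) or of its halves (2-edge). Two edges are vertex-disjoint if their row sets are disjoint and their column sets are disjoint. The opposite cells of a vertex-disjoint pair $e,f$ are the cells formed by a row of one of the two edges and a column of the other. For a 1-edge $(i,j)$ and a 2-edge $(k,l;p,q)$ they are $(i,l),(i,q),(k,j),(p,j)$. Conditions: (S) No 2-edge shares a cell with any 1-edge or with any other 2-edge. (W1) $G_1$ contains no $C_4$ (no two distinct rows have two common columns in $E_1$). (W2) $\mathcal{D}$ contains no directed cycle other than 2-cycles formed by a pair of complementary 2-edges (which are allowed). (W2') There is no nondegenerate 2-edge in $E_2$ whose two opposite cells are both 1-edges. (W3) For every vertex-disjoint pair of edges of $G$ at least one of which is a 2-edge, at least one of the opposite cells of the pair is unoccupied. *)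

theory Defs
  imports Complex_Main "HOL-Library.Extended_Nat" "HOL-Library.Disjoint_Sets"
    "Graph_Theory.Pair_Digraph"
begin

section \<open>Bilinear forms, sums of squares, SOS rank\<close>

text \<open>
  Real polynomials in the variables \<open>x\<^sub>1, \<dots>, x\<^sub>m, y\<^sub>1, \<dots>, y\<^sub>n\<close> are represented by the
  functions they induce on \<open>x, y :: nat \<Rightarrow> real\<close>. As the reals are infinite, two polynomials
  are equal iff the induced functions agree.
\<close>

type_synonym form = "(nat \<Rightarrow> real) \<Rightarrow> (nat \<Rightarrow> real) \<Rightarrow> real"

definition bilinear_form :: "nat \<Rightarrow> nat \<Rightarrow> form \<Rightarrow> bool" where
  "bilinear_form m n f \<longleftrightarrow>
     (\<exists>b :: nat \<Rightarrow> nat \<Rightarrow> real. \<forall>x y. f x y = (\<Sum>i = 1..m. \<Sum>j = 1..n. b i j * x i * y j))"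

definition sum_of_squares :: "nat \<Rightarrow> nat \<Rightarrow> nat \<Rightarrow> form \<Rightarrow> bool" where
  "sum_of_squares m n r P \<longleftrightarrow>
     (\<exists>f :: nat \<Rightarrow> form. (\<forall>p \<in> {1..r}. bilinear_form m n (f p)) \<and>
        (\<forall>x y. P x y = (\<Sum>p = 1..r. (f p x y)\<^sup>2)))"

text \<open>The rank is \<open>\<infinity>\<close> iff \<open>P\<close> is not SOS; otherwise the infimum is a minimum.\<close>

definition sos_rank :: "nat \<Rightarrow> nat \<Rightarrow> form \<Rightarrow> enat" where
  "sos_rank m n P = (INF r \<in> {r. sum_of_squares m n r P}. enat r)"


section \<open>Augmented bipartite graphs\<close>

text \<open>
  A 2-edge \<open>(i,j;k,l)\<close> is the two-element set \<open>{(i,j), (k,l)}\<close> of its halves. The 1-edges are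
  given as a set \<open>E1\<close> of cells; where 1-edges and 2-edges are treated uniformly, the 1-edge
  \<open>c\<close> is the singleton \<open>{c}\<close>.
\<close>

type_synonym cell = "nat \<times> nat"

definition augmented_bipartite_graph ::
    "nat \<Rightarrow> nat \<Rightarrow> cell set \<Rightarrow> cell set set \<Rightarrow> bool" where
  "augmented_bipartite_graph m n E1 E2 \<longleftrightarrow>
     E1 \<subseteq> {1..m} \<times> {1..n} \<and> (\<forall>e \<in> E2. e \<subseteq> {1..m} \<times> {1..n} \<and> card e = 2)"

definition assoc_form :: "cell set \<Rightarrow> cell set set \<Rightarrow> form" where
  "assoc_form E1 E2 = (\<lambda>x y.
     (\<Sum>(i, j) \<in> E1. (x i)\<^sup>2 * (y j)\<^sup>2) + (\<Sum>e \<in> E2. (\<Sum>(i, j) \<in> e. x i * y j)\<^sup>2))"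

definition nondegenerate :: "cell set \<Rightarrow> bool" where
  "nondegenerate e \<longleftrightarrow> (\<exists>i j k l. e = {(i, j), (k, l)} \<and> i \<noteq> k \<and> j \<noteq> l)"

definition occupied :: "cell set \<Rightarrow> cell set set \<Rightarrow> cell set" where
  "occupied E1 E2 = E1 \<union> \<Union> E2"

text \<open>As \<open>{(i,j), (k,l)} = {(k,l), (i,j)}\<close>, this set contains both \<open>(i,l)\<close> and \<open>(k,j)\<close>.\<close>

definition opposite_cells :: "cell set \<Rightarrow> cell set" where
  "opposite_cells e = {(i, l) | i j k l. e = {(i, j), (k, l)} \<and> i \<noteq> k \<and> j \<noteq> l}"

definition complementary :: "cell set \<Rightarrow> cell set \<Rightarrow> bool" where
  "complementary e f \<longleftrightarrow>
     (\<exists>i j k l. i \<noteq> k \<and> j \<noteq> l \<and> e = {(i, j), (k, l)} \<and> f = {(i, l), (k, j)})"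

definition dependency_graph :: "cell set \<Rightarrow> cell set set \<Rightarrow> cell set pair_pre_digraph" where
  "dependency_graph E1 E2 =
     \<lparr> pverts = {e \<in> E2. nondegenerate e},
       parcs = {(e, f). e \<in> E2 \<and> nondegenerate e \<and> f \<in> E2 \<and> nondegenerate f \<and> e \<noteq> f \<and>
                  opposite_cells e \<subseteq> occupied E1 E2 \<and> f \<inter> opposite_cells e \<noteq> {}} \<rparr>"

definition edges :: "cell set \<Rightarrow> cell set set \<Rightarrow> cell set set" where
  "edges E1 E2 = (\<lambda>c. {c}) ` E1 \<union> E2"

definition vertex_disjoint :: "cell set \<Rightarrow> cell set \<Rightarrow> bool" where
  "vertex_disjoint e f \<longleftrightarrow> fst ` e \<inter> fst ` f = {} \<and> snd ` e \<inter> snd ` f = {}"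

definition pair_opposite_cells :: "cell set \<Rightarrow> cell set \<Rightarrow> cell set" where
  "pair_opposite_cells e f = fst ` e \<times> snd ` f \<union> fst ` f \<times> snd ` e"


section \<open>The conditions\<close>

definition cond_S :: "cell set \<Rightarrow> cell set set \<Rightarrow> bool" where
  "cond_S E1 E2 \<longleftrightarrow> (\<forall>e \<in> E2. e \<inter> E1 = {}) \<and> disjoint E2"

definition cond_W1 :: "cell set \<Rightarrow> bool" where
  "cond_W1 E1 \<longleftrightarrow>
     \<not> (\<exists>i k j l. i \<noteq> k \<and> j \<noteq> l \<and> (i, j) \<in> E1 \<and> (i, l) \<in> E1 \<and> (k, j) \<in> E1 \<and> (k, l) \<in> E1)"

text \<open>
  A cycle is a nonempty list of arcs forming a closed walk without repeated vertices.
  Since \<^const>\<open>complementary\<close> is symmetric, both starting points of a 2-cycle are covered.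
\<close>

definition cond_W2 :: "cell set \<Rightarrow> cell set set \<Rightarrow> bool" where
  "cond_W2 E1 E2 \<longleftrightarrow>
     (\<forall>p. pre_digraph.cycle (with_proj (dependency_graph E1 E2)) p \<longrightarrow>
        (\<exists>e f. complementary e f \<and> p = [(e, f), (f, e)]))"

definition cond_W2' :: "cell set \<Rightarrow> cell set set \<Rightarrow> bool" where
  "cond_W2' E1 E2 \<longleftrightarrow> \<not> (\<exists>e \<in> E2. nondegenerate e \<and> opposite_cells e \<subseteq> E1)"

definition cond_W3 :: "cell set \<Rightarrow> cell set set \<Rightarrow> bool" where
  "cond_W3 E1 E2 \<longleftrightarrow>
     (\<forall>e \<in> edges E1 E2. \<forall>f \<in> edges E1 E2. (e \<in> E2 \<or> f \<in> E2) \<and> vertex_disjoint e f \<longrightarrow>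
        (\<exists>c \<in> pair_opposite_cells e f. c \<notin> occupied E1 E2))"

end

theory Submission
  imports Defs
begin

text \<open>
  Write an SOS decomposition \<open>P = \<Sum>p. f\<^sub>p\<^sup>2\<close> as \<open>P(x, y) = \<parallel>\<Sum> x\<^sub>i y\<^sub>j v(i,j)\<parallel>\<^sup>2\<close>, where \<open>v(i,j)\<close> is the
  vector of the coefficients of \<open>x\<^sub>i y\<^sub>j\<close> in the \<open>f\<^sub>p\<close>. The coefficients of \<open>P\<close> determine exactly
  the sums \<open>\<langle>v(i,j), v(k,l)\<rangle> + \<langle>v(i,l), v(k,j)\<rangle>\<close>. Hence \<open>v\<close> vanishes on unoccupied cells, is a unit
  vector on occupied cells, and agrees on the two halves of a degenerate 2-edge. If \<open>v\<close> agrees on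
  the halves of two edges, one of which is a 2-edge, then (W3) makes their vectors orthogonal.
  For a nondegenerate 2-edge \<open>(i,j;k,l)\<close> one has \<open>v(i,j) = v(k,l)\<close> as soon as the opposite
  cells are orthogonal, so this holds whenever it holds for all successors in the dependency
  graph, and also if the complementary 2-edge is present; by (W2) it then holds for all 2-edges.
  Now (W1) and (W2') make the vectors of distinct edges orthonormal, so there are at least as many
  squares as edges.
\<close>

section \<open>Bilinear forms and polarisation\<close>

lemma bilinear_form_add_left:
  "bilinear_form m n f \<Longrightarrow> f (\<lambda>k. x k + x' k) y = f x y + f x' y"
  by (auto simp: bilinear_form_def algebra_simps sum.distrib)

lemma bilinear_form_diff_left:
  "bilinear_form m n f \<Longrightarrow> f (\<lambda>k. x k - x' k) y = f x y - f x' y"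
  by (auto simp: bilinear_form_def algebra_simps sum_subtractf)

lemma bilinear_form_add_right:
  "bilinear_form m n f \<Longrightarrow> f x (\<lambda>k. y k + y' k) = f x y + f x y'"
  by (auto simp: bilinear_form_def algebra_simps sum.distrib)

lemma bilinear_form_diff_right:
  "bilinear_form m n f \<Longrightarrow> f x (\<lambda>k. y k - y' k) = f x y - f x y'"
  by (auto simp: bilinear_form_def algebra_simps sum_subtractf)

lemmas bilinear_form_simps =
  bilinear_form_add_left bilinear_form_diff_left bilinear_form_add_right bilinear_form_diff_right

text \<open>Each square is quadratic in \<open>x\<close> and in \<open>y\<close>. Differencing over
  the sign of \<open>x'\<close> and then of \<open>y'\<close> keeps only the part linear in all four
  arguments, with factors 4 and 2.\<close>

lemma sum_squares_polarisation:
  assumes f: "\<And>p. p \<in> A \<Longrightarrow> bilinear_form m n (f p)"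
    and P: "\<And>x y. P x y = (\<Sum>p\<in>A. (f p x y)\<^sup>2)"
  shows "8 * (\<Sum>p\<in>A. f p x y * f p x' y' + f p x y' * f p x' y) =
    P (\<lambda>k. x k + x' k) (\<lambda>k. y k + y' k) - P (\<lambda>k. x k - x' k) (\<lambda>k. y k + y' k)
    - P (\<lambda>k. x k + x' k) (\<lambda>k. y k - y' k) + P (\<lambda>k. x k - x' k) (\<lambda>k. y k - y' k)"
  unfolding P sum_distrib_left sum_subtractf[symmetric] sum.distrib[symmetric]
  by (rule sum.cong)
    (simp_all add: bilinear_form_simps[OF f] power2_eq_square algebra_simps)

definition unit :: "nat \<Rightarrow> nat \<Rightarrow> real" where
  "unit i k = of_bool (k = i)"

text \<open>For a bilinear form this is the coefficient at \<open>c\<close>, and 0 outside the grid.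
  Evaluation avoids choosing a coefficient matrix, which is not unique outside the grid.\<close>

definition coeff :: "form \<Rightarrow> cell \<Rightarrow> real" where
  "coeff f c = f (unit (fst c)) (unit (snd c))"

text \<open>Polarisation at unit vectors reads off, up to a constant, the coefficient of
  \<open>x\<^sub>i x\<^sub>k y\<^sub>j y\<^sub>l\<close>. This monomial arises from two pairings of
  cells, so only the sum of both inner products is determined.\<close>

lemma sum_squares_exchange:
  assumes "\<And>p. p \<in> A \<Longrightarrow> bilinear_form m n (f p)" "\<And>q. q \<in> B \<Longrightarrow> bilinear_form m n (h q)"
    and "\<And>x y. (\<Sum>p\<in>A. (f p x y)\<^sup>2) = (\<Sum>q\<in>B. (h q x y)\<^sup>2)"
  shows "(\<Sum>p\<in>A. coeff (f p) (i, j) * coeff (f p) (k, l))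
      + (\<Sum>p\<in>A. coeff (f p) (i, l) * coeff (f p) (k, j))
    = (\<Sum>q\<in>B. coeff (h q) (i, j) * coeff (h q) (k, l))
      + (\<Sum>q\<in>B. coeff (h q) (i, l) * coeff (h q) (k, j))"
proof -
  have "8 * (\<Sum>p\<in>A. f p (unit i) (unit j) * f p (unit k) (unit l)
        + f p (unit i) (unit l) * f p (unit k) (unit j))
      = 8 * (\<Sum>q\<in>B. h q (unit i) (unit j) * h q (unit k) (unit l)
        + h q (unit i) (unit l) * h q (unit k) (unit j))"
    using sum_squares_polarisation[where f = f, OF assms(1) refl]
      sum_squares_polarisation[where f = h, OF assms(2) refl] assms(3) by simp
  then show ?thesis
    by (simp add: coeff_def sum.distrib)
qed

section \<open>Orthonormal families\<close>

text \<open>By Bessel's inequality, each coordinate contributes at most 1 to the sum of the squared norms.\<close>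

lemma card_orthonormal_le:
  fixes w :: "'a \<Rightarrow> 'b \<Rightarrow> real"
  assumes "finite A" "finite S"
    and on: "\<And>s t. s \<in> S \<Longrightarrow> t \<in> S \<Longrightarrow> (\<Sum>p\<in>A. w s p * w t p) = of_bool (s = t)"
  shows "card S \<le> card A"
proof -
  have bessel: "(\<Sum>s\<in>S. w s p * w s p) \<le> 1" if p: "p \<in> A" for p
  proof -
    \<comment> \<open>\<open>u\<close> is the orthogonal projection of the \<open>p\<close>-th unit
      vector onto the span of the family, and \<open>T\<close> is its squared norm.\<close>
    define T where "T = (\<Sum>s\<in>S. w s p * w s p)"
    define u where "u q = (\<Sum>s\<in>S. w s p * w s q)" for q
    have uu: "(\<Sum>q\<in>A. u q * u q) = T"
    proof -
      have "(\<Sum>q\<in>A. u q * u q) = (\<Sum>q\<in>A. \<Sum>s\<in>S. \<Sum>t\<in>S. w s p * w t p * (w s q * w t q))"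
        unfolding u_def sum_product by (simp add: algebra_simps)
      also have "\<dots> = (\<Sum>s\<in>S. \<Sum>t\<in>S. \<Sum>q\<in>A. w s p * w t p * (w s q * w t q))"
        by (subst sum.swap) (simp add: sum.swap[of _ _ A])
      also have "\<dots> = (\<Sum>s\<in>S. \<Sum>t\<in>S. w s p * w t p * of_bool (s = t))"
        by (intro sum.cong refl) (simp add: on sum_distrib_left[symmetric])
      also have "\<dots> = T"
        using \<open>finite S\<close> by (simp add: T_def if_distrib sum.delta of_bool_def cong: if_cong)
      finally show ?thesis .
    qed
    \<comment> \<open>The squared distance from the unit vector to its projection; as
      \<open>u p = T\<close>, it equals \<open>1 - T\<close>.\<close>
    have "0 \<le> (\<Sum>q\<in>A. (of_bool (q = p) - u q)\<^sup>2)"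
      by (intro sum_nonneg) simp
    also have "\<dots> = (\<Sum>q\<in>A. of_bool (q = p) - 2 * (if q = p then u q else 0) + u q * u q)"
      by (intro sum.cong) (auto simp: power2_eq_square algebra_simps)
    also have "\<dots> = 1 - 2 * u p + T"
      using \<open>finite A\<close> p uu
      by (simp add: sum.distrib sum_subtractf sum_distrib_left[symmetric] of_bool_def sum.delta)
    finally show ?thesis
      by (simp add: u_def T_def)
  qed
  have "real (card S) = (\<Sum>s\<in>S. \<Sum>p\<in>A. w s p * w s p)"
    by (simp add: on)
  also have "\<dots> = (\<Sum>p\<in>A. \<Sum>s\<in>S. w s p * w s p)"
    by (rule sum.swap)
  also have "\<dots> \<le> (\<Sum>p\<in>A. 1)"
    by (intro sum_mono bessel)
  finally show ?thesis
    by simp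
qed

section \<open>Cycles in finite digraphs\<close>

text \<open>Following arcs inside \<open>U\<close> never stops, so finiteness rules out acyclicity.
  Working in the subgraph \<open>H\<close> induced on \<open>U\<close> keeps the cycle inside
  \<open>U\<close>.\<close>

lemma exists_cycle_within:
  fixes G :: "'a pair_pre_digraph"
  assumes "finite U" "U \<noteq> {}" "U \<subseteq> pverts G"
    and succ: "\<And>u. u \<in> U \<Longrightarrow> \<exists>w\<in>U. (u, w) \<in> parcs G"
  shows "\<exists>p. pre_digraph.cycle (with_proj G) p \<and> fst ` set p \<subseteq> U"
proof -
  define R where "R = parcs G \<inter> U \<times> U"
  define H where "H = \<lparr>pverts = U, parcs = R\<rparr>"
  interpret pair_wf_digraph H
    by unfold_locales (auto simp: H_def R_def)
  have "\<not> wf (R\<inverse>)"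
  proof
    assume "wf (R\<inverse>)"
    moreover obtain u where "u \<in> U"
      using assms(2) by blast
    ultimately obtain z where "z \<in> U" "\<And>y. (y, z) \<in> R\<inverse> \<Longrightarrow> y \<notin> U"
      by (rule wfE_min) blast
    moreover obtain w where "w \<in> U" "(z, w) \<in> parcs G"
      using succ \<open>z \<in> U\<close> by blast
    ultimately show False
      unfolding R_def by blast
  qed
  moreover have "finite (R\<inverse>)"
    using assms(1) by (auto simp: R_def)
  ultimately have "\<not> acyclic R"
    using finite_acyclic_wf by (metis acyclic_converse)
  then obtain u where "(u, u) \<in> R\<^sup>+"
    by (auto simp: acyclic_def)
  then have "\<exists>p. awalk u p u \<and> p \<noteq> []"
    using reachable1_awalk[of u u] by (simp add: H_def)
  then obtain p where "cycle p"
    using closed_w_imp_cycle by (auto simp: closed_w_def)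
  \<comment> \<open>A cycle of \<open>H\<close> is one of \<open>G\<close>, because its vertices and
    arcs belong to \<open>G\<close>.\<close>
  then have "pre_digraph.cycle (with_proj G) p \<and> fst ` set p \<subseteq> U"
    using assms(3)
    by (auto simp: pre_digraph.cycle_def pre_digraph.awalk_def cas_with_proj_eq
        awalk_verts_with_proj_eq H_def R_def)
  then show ?thesis ..
qed

section \<open>The form of an augmented bipartite graph\<close>

text \<open>Treats both kinds of edges alike: for a singleton the square is the monomial of a
  1-edge.\<close>

definition edge_form :: "cell set \<Rightarrow> form" where
  "edge_form e x y = (\<Sum>(i, j)\<in>e. x i * y j)"

lemma bilinear_form_edge_form:
  assumes "e \<subseteq> {1..m} \<times> {1..n}"
  shows "bilinear_form m n (edge_form e)"
  unfolding bilinear_form_def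
proof (intro exI allI)
  fix x y
  have "edge_form e x y = (\<Sum>(i, j)\<in>{1..m} \<times> {1..n}. of_bool ((i, j) \<in> e) * x i * y j)"
    unfolding edge_form_def using assms by (intro sum.mono_neutral_cong_left) auto
  then show "edge_form e x y = (\<Sum>i = 1..m. \<Sum>j = 1..n. of_bool ((i, j) \<in> e) * x i * y j)"
    by (simp add: sum.cartesian_product)
qed

lemma coeff_edge_form:
  assumes "finite e"
  shows "coeff (edge_form e) c = of_bool (c \<in> e)"
proof -
  have "coeff (edge_form e) c = (\<Sum>d\<in>e. if d = c then 1 else 0)"
    unfolding coeff_def edge_form_def by (intro sum.cong) (auto simp: unit_def)
  then show ?thesis
    using assms by (simp add: sum.delta of_bool_def)
qed

locale augmented_graph =
  fixes m n :: nat and E1 :: "cell set" and E2 :: "cell set set"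
  assumes graph: "augmented_bipartite_graph m n E1 E2"
    and S: "cond_S E1 E2"
begin

lemma edge_subset: "e \<in> edges E1 E2 \<Longrightarrow> e \<subseteq> {1..m} \<times> {1..n}"
  using graph by (auto simp: augmented_bipartite_graph_def edges_def)

lemma finite_edge: "e \<in> edges E1 E2 \<Longrightarrow> finite e"
  using edge_subset by (rule finite_subset) auto

lemma finite_edges: "finite (edges E1 E2)"
  by (rule finite_subset[of _ "Pow ({1..m} \<times> {1..n})"]) (use edge_subset in auto)

lemma card_2_edge: "e \<in> E2 \<Longrightarrow> card e = 2"
  using graph by (auto simp: augmented_bipartite_graph_def)

lemma singletons_Int_E2: "(\<lambda>c. {c}) ` E1 \<inter> E2 = {}"
  using card_2_edge by fastforce

lemma finite_E1: "finite E1" and finite_E2: "finite E2"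
  using finite_edges finite_imageD[of "\<lambda>c. {c}" E1] by (auto simp: edges_def inj_on_def)

lemma card_edges: "card (edges E1 E2) = card E1 + card E2"
  unfolding edges_def using finite_E1 finite_E2 singletons_Int_E2
  by (simp add: card_Un_disjoint card_image inj_on_def)

lemma edges_unique: "e \<in> edges E1 E2 \<Longrightarrow> f \<in> edges E1 E2 \<Longrightarrow> c \<in> e \<Longrightarrow> c \<in> f \<Longrightarrow> e = f"
  using S unfolding edges_def cond_S_def disjoint_def by (fastforce del: equalityI)

lemma edge_nonempty: "e \<in> edges E1 E2 \<Longrightarrow> e \<noteq> {}"
  using card_2_edge by (fastforce simp: edges_def)

lemma occupied_iff: "c \<in> occupied E1 E2 \<longleftrightarrow> (\<exists>e\<in>edges E1 E2. c \<in> e)"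
  by (auto simp: occupied_def edges_def)

lemma assoc_form_eq: "assoc_form E1 E2 x y = (\<Sum>e\<in>edges E1 E2. (edge_form e x y)\<^sup>2)"
proof -
  have "(\<Sum>e\<in>(\<lambda>c. {c}) ` E1. (edge_form e x y)\<^sup>2) = (\<Sum>(i, j)\<in>E1. (x i)\<^sup>2 * (y j)\<^sup>2)"
    by (subst sum.reindex) (auto simp: inj_on_def edge_form_def power_mult_distrib intro!: sum.cong)
  then show ?thesis
    unfolding edges_def assoc_form_def using finite_E1 finite_E2 singletons_Int_E2
    by (subst sum.union_disjoint) (auto simp: edge_form_def)
qed

text \<open>This is the upper bound for the rank: one square per edge.\<close>

lemma sum_of_squares_assoc_form: "sum_of_squares m n (card E1 + card E2) (assoc_form E1 E2)"
proof -
  obtain h where h: "bij_betw h {1..card (edges E1 E2)} (edges E1 E2)"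
    using ex_bij_betw_nat_finite_1[OF finite_edges] by blast
  have "assoc_form E1 E2 x y = (\<Sum>p = 1..card (edges E1 E2). (edge_form (h p) x y)\<^sup>2)" for x y
    unfolding assoc_form_eq by (rule sum.reindex_bij_betw[OF h, symmetric])
  moreover have "bilinear_form m n (edge_form (h p))" if "p \<in> {1..card (edges E1 E2)}" for p
    using bij_betwE[OF h] that by (auto intro!: bilinear_form_edge_form edge_subset)
  ultimately show ?thesis
    unfolding sum_of_squares_def card_edges by (intro exI[of _ "\<lambda>p. edge_form (h p)"]) auto
qed

definition same_edge :: "cell \<Rightarrow> cell \<Rightarrow> bool" where
  "same_edge c d \<longleftrightarrow> (\<exists>e\<in>edges E1 E2. c \<in> e \<and> d \<in> e)"

lemma same_edge_refl: "same_edge c c \<longleftrightarrow> c \<in> occupied E1 E2"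
  by (auto simp: same_edge_def occupied_iff)

lemma same_edge_sym: "same_edge c d \<longleftrightarrow> same_edge d c"
  by (auto simp: same_edge_def)

lemma same_edge_iff_eq:
  "c \<in> e \<Longrightarrow> e \<in> edges E1 E2 \<Longrightarrow> d \<in> f \<Longrightarrow> f \<in> edges E1 E2 \<Longrightarrow> same_edge c d \<longleftrightarrow> e = f"
  unfolding same_edge_def by (metis edges_unique)

lemma same_edge_2_edge:
  assumes "same_edge c d" "c \<noteq> d"
  shows "{c, d} \<in> E2"
proof -
  obtain e where e: "e \<in> edges E1 E2" "c \<in> e" "d \<in> e"
    using assms(1) by (auto simp: same_edge_def)
  then have "e \<in> E2"
    using assms(2) by (auto simp: edges_def)
  moreover have "e = {c, d}"
    using card_2_edge[OF \<open>e \<in> E2\<close>] e assms(2) by (auto simp: card_2_iff)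
  ultimately show ?thesis
    by simp
qed

text \<open>By (S) a cell lies on at most one edge, so at most one summand is nonzero. Thus
  \<open>same_edge\<close>, as a 0-1 matrix, is the Gram matrix of the decomposition into edge
  forms.\<close>

lemma sum_coeff_edge_forms:
  "(\<Sum>e\<in>edges E1 E2. coeff (edge_form e) c * coeff (edge_form e) d) = of_bool (same_edge c d)"
proof (cases "same_edge c d")
  case True
  then obtain e where e: "e \<in> edges E1 E2" "c \<in> e" "d \<in> e"
    by (auto simp: same_edge_def)
  have "(\<Sum>f\<in>edges E1 E2. coeff (edge_form f) c * coeff (edge_form f) d)
      = (\<Sum>f\<in>edges E1 E2. if f = e then 1 else 0)"
  proof (intro sum.cong refl)
    fix f assume "f \<in> edges E1 E2"
    then show "coeff (edge_form f) c * coeff (edge_form f) d = (if f = e then 1 else 0)"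
      using e edges_unique[of f e c] by (cases "f = e") (auto simp: coeff_edge_form finite_edge)
  qed
  then show ?thesis
    using True e finite_edges by (simp add: sum.delta)
next
  case False
  then have "coeff (edge_form e) c * coeff (edge_form e) d = 0" if "e \<in> edges E1 E2" for e
    using that by (simp add: coeff_edge_form finite_edge same_edge_def)
  then show ?thesis
    using False by (simp add: sum.neutral del: mult_eq_0_iff)
qed

end

section \<open>Gram vectors of a decomposition\<close>

text \<open>Of a decomposition only the exchange identity is kept; its right-hand side is the same
  expression for the decomposition into edge forms.\<close>

locale gram_vectors = augmented_graph +
  fixes A :: "'a set" and v :: "cell \<Rightarrow> 'a \<Rightarrow> real"
  assumes W1: "cond_W1 E1" and W2: "cond_W2 E1 E2" and W2': "cond_W2' E1 E2"
    and W3: "cond_W3 E1 E2"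
    and finite_A: "finite A"
    and exchange: "(\<Sum>p\<in>A. v (i, j) p * v (k, l) p) + (\<Sum>p\<in>A. v (i, l) p * v (k, j) p) =
      of_bool (same_edge (i, j) (k, l)) + of_bool (same_edge (i, l) (k, j))"
begin

definition gram :: "cell \<Rightarrow> cell \<Rightarrow> real" where
  "gram c d = (\<Sum>p\<in>A. v c p * v d p)"

lemma gram_exchange:
  "gram (i, j) (k, l) + gram (i, l) (k, j) =
    of_bool (same_edge (i, j) (k, l)) + of_bool (same_edge (i, l) (k, j))"
  unfolding gram_def by (rule exchange)

lemma gram_sym: "gram c d = gram d c"
  by (simp add: gram_def mult.commute)

text \<open>In a common row both terms of the exchange identity coincide, so it determines the inner
  product itself. The same happens in a common column.\<close>

lemma gram_row: "gram (i, j) (i, l) = of_bool (same_edge (i, j) (i, l))"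
  using gram_exchange[of i j i l] by (simp add: gram_sym[of "(i, l)"] same_edge_sym[of "(i, l)"])

lemma gram_col: "gram (i, j) (k, j) = of_bool (same_edge (i, j) (k, j))"
  using gram_exchange[of i j k j] by simp

lemma gram_refl: "gram c c = of_bool (c \<in> occupied E1 E2)"
  by (cases c) (simp only: gram_row same_edge_refl)

lemma gram_unoccupied:
  assumes "c \<notin> occupied E1 E2"
  shows "gram c d = 0"
proof -
  have "(\<Sum>p\<in>A. v c p * v c p) = 0"
    using gram_refl[of c] assms by (simp add: gram_def)
  then have "\<forall>p\<in>A. v c p * v c p = 0"
    using sum_nonneg_eq_0_iff[OF finite_A, of "\<lambda>p. v c p * v c p"] by simp
  then show ?thesis
    by (simp add: gram_def)
qed

lemma sum_diff_squares: "(\<Sum>p\<in>A. (v c p - v d p)\<^sup>2) = gram c c + gram d d - 2 * gram c d"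
  by (simp add: gram_def power2_eq_square algebra_simps sum.distrib sum_subtractf sum_distrib_left)

lemma gram_le_1:
  assumes "c \<in> occupied E1 E2" "d \<in> occupied E1 E2"
  shows "gram c d \<le> 1"
proof -
  have "0 \<le> (\<Sum>p\<in>A. (v c p - v d p)\<^sup>2)"
    by (intro sum_nonneg) simp
  then show ?thesis
    using assms by (simp add: sum_diff_squares gram_refl)
qed

text \<open>The equality case of Cauchy-Schwarz: unit vectors with inner product 1 coincide.\<close>

lemma gram_eq_1_cong:
  assumes "c \<in> occupied E1 E2" "d \<in> occupied E1 E2" "gram c d = 1"
  shows "gram c a = gram d a"
proof -
  have "(\<Sum>p\<in>A. (v c p - v d p)\<^sup>2) = 0"
    using assms by (simp add: sum_diff_squares gram_refl)
  then have "\<forall>p\<in>A. v c p = v d p"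
    by (subst (asm) sum_nonneg_eq_0_iff) (auto simp: finite_A)
  then show ?thesis
    by (simp add: gram_def)
qed

section \<open>Edges whose cells share one unit vector\<close>

definition merged :: "cell set \<Rightarrow> bool" where
  "merged e \<longleftrightarrow> (\<forall>c\<in>e. \<forall>d\<in>e. gram c d = 1)"

lemma mergedI:
  assumes "{c, d} \<in> E2" "gram c d = 1"
  shows "merged {c, d}"
  using assms by (auto simp: merged_def gram_refl occupied_def gram_sym[of d])

lemma merged_cong:
  "merged e \<Longrightarrow> e \<in> edges E1 E2 \<Longrightarrow> c \<in> e \<Longrightarrow> c' \<in> e \<Longrightarrow> gram c d = gram c' d"
  by (rule gram_eq_1_cong) (auto simp: merged_def occupied_iff)

lemma merged_singleton: "c \<in> E1 \<Longrightarrow> merged {c}"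
  by (simp add: merged_def gram_refl occupied_def)

lemma merged_degenerate:
  assumes "e \<in> E2" "\<not> nondegenerate e"
  shows "merged e"
proof -
  obtain c d where e: "e = {c, d}"
    using card_2_edge[OF assms(1)] by (auto simp: card_2_iff)
  obtain i j k l where cd: "c = (i, j)" "d = (k, l)"
    by fastforce
  have "same_edge c d"
    using assms(1) e by (auto simp: same_edge_def edges_def)
  moreover have "i = k \<or> j = l"
    using assms(2) unfolding e cd nondegenerate_def by blast
  ultimately have "gram c d = 1"
    unfolding cd by (auto simp: gram_row gram_col)
  then show ?thesis
    using assms(1) mergedI unfolding e by blast
qed

text \<open>The two inner products add up to 2 and neither exceeds 1, so both equal 1.\<close>

lemma merged_complementary:
  assumes "e \<in> E2" "f \<in> E2" "complementary e f"
  shows "merged e"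
proof -
  obtain i j k l where e: "e = {(i, j), (k, l)}" and f: "f = {(i, l), (k, j)}"
    using assms(3) by (auto simp: complementary_def)
  have "same_edge (i, j) (k, l)" "same_edge (i, l) (k, j)"
    using assms(1,2) unfolding e f same_edge_def edges_def by blast+
  then have "gram (i, j) (k, l) + gram (i, l) (k, j) = 2"
    by (simp add: gram_exchange)
  moreover have "gram (i, j) (k, l) \<le> 1" "gram (i, l) (k, j) \<le> 1"
    using assms(1,2) unfolding e f occupied_def by (blast intro: gram_le_1[unfolded occupied_def])+
  ultimately have "gram (i, j) (k, l) = 1"
    by linarith
  then show ?thesis
    using assms(1) mergedI unfolding e by blast
qed

lemma gram_opposite_unoccupied:
  assumes "(i, l) \<notin> occupied E1 E2 \<or> (k, j) \<notin> occupied E1 E2"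
  shows "gram (i, j) (k, l) = of_bool (same_edge (i, j) (k, l))"
proof -
  have "gram (i, l) (k, j) = 0"
    using assms gram_unoccupied gram_sym by metis
  moreover have "\<not> same_edge (i, l) (k, j)"
    using assms by (auto simp: same_edge_def occupied_iff)
  ultimately show ?thesis
    using gram_exchange[of i j k l] by simp
qed

text \<open>A merged edge has a single vector, so one orthogonal pair of cells suffices. It comes
  from (W3) for vertex-disjoint edges, and from a common row or column otherwise.\<close>

lemma merged_orthogonal:
  assumes "e \<in> edges E1 E2" "f \<in> edges E1 E2" "e \<noteq> f" "e \<in> E2 \<or> f \<in> E2"
    and "merged e" "merged f" "c \<in> e" "d \<in> f"
  shows "gram c d = 0"
proof -
  have "\<exists>c'\<in>e. \<exists>d'\<in>f. gram c' d' = 0"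
  proof (cases "vertex_disjoint e f")
    case True
    then obtain a where a: "a \<in> pair_opposite_cells e f" "a \<notin> occupied E1 E2"
      using W3 assms(1-4) unfolding cond_W3_def by blast
    then obtain i j k l where ij: "(i, j) \<in> e" and kl: "(k, l) \<in> f"
      and "(i, l) \<notin> occupied E1 E2 \<or> (k, j) \<notin> occupied E1 E2"
      by (fastforce simp: pair_opposite_cells_def)
    moreover have "\<not> same_edge (i, j) (k, l)"
      using same_edge_iff_eq[OF ij assms(1) kl assms(2)] assms(3) by simp
    ultimately show ?thesis
      using gram_opposite_unoccupied[of i l k j] by auto
  next
    case False
    then obtain i j k l where ij: "(i, j) \<in> e" and kl: "(k, l) \<in> f" and "i = k \<or> j = l"
      by (fastforce simp: vertex_disjoint_def)
    moreover have "\<not> same_edge (i, j) (k, l)"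
      using same_edge_iff_eq[OF ij assms(1) kl assms(2)] assms(3) by simp
    ultimately have "gram (i, j) (k, l) = 0"
      by (auto simp: gram_row gram_col)
    with ij kl show ?thesis
      by blast
  qed
  then obtain c' d' where "c' \<in> e" "d' \<in> f" "gram c' d' = 0"
    by blast
  then show ?thesis
    using merged_cong[of e c c' d] merged_cong[of f d d' c'] assms gram_sym by metis
qed

text \<open>If \<open>e\<close> were not merged, every nondegenerate 2-edge through an opposite cell
  would be a successor. The edges through the two opposite cells are then merged and distinct, hence
  orthogonal, and the exchange identity gives inner product 1.\<close>

lemma merged_step:
  assumes e: "e \<in> E2" "nondegenerate e"
    and succ: "\<And>f. (e, f) \<in> parcs (dependency_graph E1 E2) \<Longrightarrow> merged f"
  shows "merged e"
proof (rule ccontr)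
  assume "\<not> merged e"
  obtain i j k l where eq: "e = {(i, j), (k, l)}" and ne: "i \<noteq> k" "j \<noteq> l"
    using e(2) by (auto simp: nondegenerate_def)
  have "same_edge (i, j) (k, l)"
    using e eq by (auto simp: same_edge_def edges_def)
  have not_1: "gram (i, j) (k, l) \<noteq> 1"
    using \<open>\<not> merged e\<close> e(1) mergedI unfolding eq by blast
  \<comment> \<open>An unoccupied opposite cell would already force inner product 1.\<close>
  have occ: "(i, l) \<in> occupied E1 E2" "(k, j) \<in> occupied E1 E2"
    using not_1 gram_opposite_unoccupied[of i l k j] \<open>same_edge (i, j) (k, l)\<close> by auto
  have no_compl: "{(i, l), (k, j)} \<notin> E2"
    using merged_complementary[OF e(1)] \<open>\<not> merged e\<close> eq ne unfolding complementary_def by blast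
  then have not_same: "\<not> same_edge (i, l) (k, j)"
    using same_edge_2_edge ne by blast
  have opp: "opposite_cells e = {(i, l), (k, j)}"
    using ne unfolding opposite_cells_def eq by (auto simp: doubleton_eq_iff)
  have merged_opp: "merged f" if f: "f \<in> edges E1 E2" and c: "c \<in> f" "c \<in> {(i, l), (k, j)}" for f c
  proof (cases "f \<in> E2 \<and> nondegenerate f")
    case True
    have "f \<noteq> e"
      using c ne eq by auto
    then have "(e, f) \<in> parcs (dependency_graph E1 E2)"
      using True e c occ unfolding dependency_graph_def by (auto simp: opp)
    then show ?thesis
      by (rule succ)
  next
    case False
    then show ?thesis
      using f merged_singleton merged_degenerate by (auto simp: edges_def)
  qed
  obtain f g where fg: "f \<in> edges E1 E2" "(i, l) \<in> f" "g \<in> edges E1 E2" "(k, j) \<in> g"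
    using occ by (auto simp: occupied_iff)
  have "f \<noteq> g"
    using not_same same_edge_iff_eq[OF fg(2,1,4,3)] by simp
  \<comment> \<open>Here (W2') enters: the opposite cells are not both 1-edges.\<close>
  moreover have "f \<in> E2 \<or> g \<in> E2"
    using W2' e fg opp by (auto simp: cond_W2'_def edges_def)
  ultimately have "gram (i, l) (k, j) = 0"
    using fg merged_opp by (intro merged_orthogonal[of f g]) auto
  then show False
    using gram_exchange[of i j k l] \<open>same_edge (i, j) (k, l)\<close> not_same not_1 by simp
qed

text \<open>Otherwise every unmerged 2-edge has an unmerged successor, which yields a cycle of
  unmerged 2-edges. By (W2) it is a complementary pair, and such 2-edges are merged.\<close>

lemma merged_2_edge:
  assumes "e \<in> E2"
  shows "merged e"
proof (rule ccontr)
  assume "\<not> merged e"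
  define U where "U = {f \<in> E2. \<not> merged f}"
  have "finite U" "U \<noteq> {}"
    using finite_E2 assms \<open>\<not> merged e\<close> by (auto simp: U_def)
  moreover have "U \<subseteq> pverts (dependency_graph E1 E2)"
    using merged_degenerate by (auto simp: U_def dependency_graph_def)
  moreover have "\<exists>w\<in>U. (u, w) \<in> parcs (dependency_graph E1 E2)" if u: "u \<in> U" for u
  proof -
    obtain w where "(u, w) \<in> parcs (dependency_graph E1 E2)" "\<not> merged w"
      using u merged_step[of u] merged_degenerate[of u] unfolding U_def by blast
    then show ?thesis
      by (auto simp: U_def dependency_graph_def)
  qed
  ultimately obtain p where p: "pre_digraph.cycle (with_proj (dependency_graph E1 E2)) p"
    "fst ` set p \<subseteq> U"
    using exists_cycle_within by meson
  then obtain f g where "complementary f g" "p = [(f, g), (g, f)]"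
    using W2 unfolding cond_W2_def by blast
  then show False
    using p(2) merged_complementary[of f g] by (auto simp: U_def)
qed

section \<open>Orthonormality of the edge vectors\<close>

lemma merged_edge: "e \<in> edges E1 E2 \<Longrightarrow> merged e"
  using merged_2_edge merged_singleton by (auto simp: edges_def)

text \<open>(W3) does not cover two 1-edges. If both opposite cells are occupied, the edges through
  them are orthogonal, and the exchange identity carries this over to \<open>c\<close> and
  \<open>d\<close>.\<close>

lemma gram_1_edges:
  assumes "c \<in> E1" "d \<in> E1" "c \<noteq> d"
  shows "gram c d = 0"
proof -
  obtain i j k l where cd: "c = (i, j)" "d = (k, l)"
    by fastforce
  have edge: "{c} \<in> edges E1 E2" "{d} \<in> edges E1 E2"
    using assms by (auto simp: edges_def)
  then have not_same: "\<not> same_edge (i, j) (k, l)"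
    using same_edge_iff_eq[of c "{c}" d "{d}"] assms(3) by (simp add: cd)
  show ?thesis
  proof (cases "i = k \<or> j = l \<or> (i, l) \<notin> occupied E1 E2 \<or> (k, j) \<notin> occupied E1 E2")
    case True
    then show ?thesis
      using not_same gram_opposite_unoccupied[of i l k j]
      unfolding cd by (auto simp: gram_row gram_col)
  next
    case False
    then obtain f g where fg: "f \<in> edges E1 E2" "(i, l) \<in> f" "g \<in> edges E1 E2" "(k, j) \<in> g"
      by (auto simp: occupied_iff)
    \<comment> \<open>The opposite cells of \<open>{(i, l), (k, j)}\<close> are \<open>c\<close> and
      \<open>d\<close>, so (W2') forbids it as a 2-edge.\<close>
    have opp_subset: "opposite_cells {(i, l), (k, j)} \<subseteq> E1"
      using assms(1,2) False unfolding opposite_cells_def cd by (auto simp: doubleton_eq_iff)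
    have "{(i, l), (k, j)} \<notin> E2"
    proof
      assume "{(i, l), (k, j)} \<in> E2"
      moreover have "nondegenerate {(i, l), (k, j)}"
        using False unfolding nondegenerate_def by blast
      ultimately show False
        using W2' opp_subset unfolding cond_W2'_def by blast
    qed
    then have not_same': "\<not> same_edge (i, l) (k, j)"
      using same_edge_2_edge False by blast
    then have "f \<noteq> g"
      using same_edge_iff_eq[OF fg(2,1,4,3)] by simp
    \<comment> \<open>Two 1-edges here would complete a \<open>C_4\<close> with \<open>c\<close> and
      \<open>d\<close>, against (W1).\<close>
    moreover have "f \<in> E2 \<or> g \<in> E2"
      using W1 fg assms(1,2) False unfolding cond_W1_def cd by (auto simp: edges_def)
    ultimately have "gram (i, l) (k, j) = 0"
      using fg merged_edge by (intro merged_orthogonal[of f g]) auto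
    then show ?thesis
      using gram_exchange[of i j k l] not_same not_same' by (simp add: cd)
  qed
qed

lemma card_edges_le: "card (edges E1 E2) \<le> card A"
proof -
  \<comment> \<open>Any cell of an edge will do, since a merged edge has a single vector.\<close>
  define rep where "rep e = (SOME c. c \<in> e)" for e :: "cell set"
  have rep: "rep e \<in> e" if "e \<in> edges E1 E2" for e
    using edge_nonempty[OF that] by (simp add: rep_def some_in_eq)
  have "gram (rep e) (rep f) = of_bool (e = f)" if e: "e \<in> edges E1 E2" and f: "f \<in> edges E1 E2" for e f
  proof (cases "e = f")
    case True
    then show ?thesis
      using merged_edge[OF e] rep[OF e] by (simp add: merged_def)
  next
    case ne: False
    show ?thesis
    proof (cases "e \<in> E2 \<or> f \<in> E2")
      case True
      then show ?thesis
        using ne e f merged_orthogonal[OF e f ne True] merged_edge rep by simp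
    next
      case False
      then obtain c d where "c \<in> E1" "d \<in> E1" "e = {c}" "f = {d}"
        using e f by (auto simp: edges_def)
      then show ?thesis
        using ne gram_1_edges rep[OF e] rep[OF f] by auto
    qed
  qed
  then show ?thesis
    using finite_A finite_edges
    by (intro card_orthonormal_le[where w = "\<lambda>e. v (rep e)"]) (auto simp: gram_def)
qed

end

theorem theorem7:
  fixes m n :: nat
    and E1 :: "cell set" and E2 :: "cell set set"
  assumes "m \<ge> n" and "n \<ge> 2"
    and "augmented_bipartite_graph m n E1 E2"
    and "cond_S E1 E2"
    and "cond_W1 E1"
    and "cond_W2 E1 E2"
    and "cond_W2' E1 E2"
    and "cond_W3 E1 E2"
  shows "sos_rank m n (assoc_form E1 E2) = enat (card E1 + card E2)"
proof -
  interpret augmented_graph m n E1 E2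
    using assms by unfold_locales
  have lower: "card E1 + card E2 \<le> r" if sos: "sum_of_squares m n r (assoc_form E1 E2)" for r
  proof -
    obtain f where f: "\<And>p. p \<in> {1..r} \<Longrightarrow> bilinear_form m n (f p)"
      and sum_f: "\<And>x y. assoc_form E1 E2 x y = (\<Sum>p = 1..r. (f p x y)\<^sup>2)"
      using sos unfolding sum_of_squares_def by blast
    \<comment> \<open>The given decomposition is compared with the one into edge forms.\<close>
    interpret gram_vectors m n E1 E2 "{1..r}" "\<lambda>c p. coeff (f p) c"
    proof unfold_locales
      fix i j k l
      show "(\<Sum>p = 1..r. coeff (f p) (i, j) * coeff (f p) (k, l))
          + (\<Sum>p = 1..r. coeff (f p) (i, l) * coeff (f p) (k, j))
        = of_bool (same_edge (i, j) (k, l)) + of_bool (same_edge (i, l) (k, j))"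
        unfolding sum_coeff_edge_forms[symmetric]
        by (rule sum_squares_exchange[OF f])
          (simp_all only: sum_f[symmetric] assoc_form_eq bilinear_form_edge_form[OF edge_subset])
    qed (use assms in auto)
    show ?thesis
      using card_edges_le by (simp add: card_edges)
  qed
  show ?thesis
    unfolding sos_rank_def
  proof (rule antisym)
    show "(INF r \<in> {r. sum_of_squares m n r (assoc_form E1 E2)}. enat r) \<le> enat (card E1 + card E2)"
      using sum_of_squares_assoc_form by (intro INF_lower) simp
    show "enat (card E1 + card E2) \<le> (INF r \<in> {r. sum_of_squares m n r (assoc_form E1 E2)}. enat r)"
      using lower by (intro INF_greatest) simp
  qed
qed

end
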